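(* Let $p$ be a prime and let $(A, +, \cdot)$ be a nilpotent (associative, not necessarily commutative, non-unital) $\mathbb{F}_p$-algebra of finite $\mathbb{F}_p$-dimension $n$. Define the circle operation on $A$ by \[ a \circ b = a + b + a\cdot b \qquad (a,b\in A). \] Then $(A, \circ, +)$ is a bi-skew brace if and only if $A^3 = 0$, i.e. if and only if $a\cdot b\cdot c = 0$ for all $a, b, c \in A$.
   Context: A bi-skew brace $(B,\circ,\star)$ is a finite set $B$ with two operations $\star$ and $\circ$ such that $(B,\star)$ is a group, $(B,\circ)$ is a group, and both compatibility conditions \[ a \circ (b \star c) = (a \circ b) \star a^{-1} \star (a \circ c), \qquad a \star (b \circ c) = (a \star b) \circ \overline{a} \circ (a \star c) \] hold for all $a,b,c\in B$, where $a^{-1}$ is the inverse of $a$ in $(B,\star)$ and $\overline{a}$ is the inverse of $a$ in $(B,\circ)$. Here the operation $\star$ is the addition $+$ of $A$, so that $a^{-1}=-a$. *)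

theory Defs
  imports "HOL-Number_Theory.Residues" "Jordan_Normal_Form.Missing_VectorSpace"
begin

(* The finite set B is the common carrier of the two group records: C is the group (B, circ),
   S is the group (B, star). *)
locale bi_skew_brace = circ: group C + star: group S
  for C :: "('a, 'm) monoid_scheme" and S :: "('a, 'k) monoid_scheme" +
  assumes same_carrier: "carrier C = carrier S"
    and finite_carrier: "finite (carrier S)"
    and brace: "\<lbrakk>a \<in> carrier S; b \<in> carrier S; c \<in> carrier S\<rbrakk> \<Longrightarrow>
      a \<otimes>\<^bsub>C\<^esub> (b \<otimes>\<^bsub>S\<^esub> c) = (a \<otimes>\<^bsub>C\<^esub> b) \<otimes>\<^bsub>S\<^esub> inv\<^bsub>S\<^esub> a \<otimes>\<^bsub>S\<^esub> (a \<otimes>\<^bsub>C\<^esub> c)"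
    and dual_brace: "\<lbrakk>a \<in> carrier S; b \<in> carrier S; c \<in> carrier S\<rbrakk> \<Longrightarrow>
      a \<otimes>\<^bsub>S\<^esub> (b \<otimes>\<^bsub>C\<^esub> c) = (a \<otimes>\<^bsub>S\<^esub> b) \<otimes>\<^bsub>C\<^esub> inv\<^bsub>C\<^esub> a \<otimes>\<^bsub>C\<^esub> (a \<otimes>\<^bsub>S\<^esub> c)"

(* The library locale algebra demands a commutative unital ring, so it is not used here.
   The field one of the record A is left unconstrained. *)
locale nonunital_algebra = vectorspace K A
  for K :: "('k, 'l) ring_scheme" and A :: "('k, 'a, 'm) module_scheme" (structure) +
  assumes mult_closed: "\<lbrakk>x \<in> carrier A; y \<in> carrier A\<rbrakk> \<Longrightarrow> x \<otimes> y \<in> carrier A"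
    and mult_assoc: "\<lbrakk>x \<in> carrier A; y \<in> carrier A; z \<in> carrier A\<rbrakk> \<Longrightarrow>
      (x \<otimes> y) \<otimes> z = x \<otimes> (y \<otimes> z)"
    and mult_l_distr: "\<lbrakk>x \<in> carrier A; y \<in> carrier A; z \<in> carrier A\<rbrakk> \<Longrightarrow>
      (x \<oplus> y) \<otimes> z = x \<otimes> z \<oplus> y \<otimes> z"
    and mult_r_distr: "\<lbrakk>x \<in> carrier A; y \<in> carrier A; z \<in> carrier A\<rbrakk> \<Longrightarrow>
      x \<otimes> (y \<oplus> z) = x \<otimes> y \<oplus> x \<otimes> z"
    and smult_mult_left: "\<lbrakk>r \<in> carrier K; x \<in> carrier A; y \<in> carrier A\<rbrakk> \<Longrightarrow>
      (r \<odot> x) \<otimes> y = r \<odot> (x \<otimes> y)"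
    and smult_mult_right: "\<lbrakk>r \<in> carrier K; x \<in> carrier A; y \<in> carrier A\<rbrakk> \<Longrightarrow>
      x \<otimes> (r \<odot> y) = r \<odot> (x \<otimes> y)"

(* A^k: the subspace spanned by all products of k elements of A. Meaningful only for k > 0:
   without a unit there is no empty product, and alg_pow 0 is the zero subspace. *)
definition (in nonunital_algebra) alg_pow :: "nat \<Rightarrow> 'a set" where
  "alg_pow k = span {foldl (\<otimes>) x xs | x xs.
     x \<in> carrier A \<and> set xs \<subseteq> carrier A \<and> Suc (length xs) = k}"

locale nilpotent_algebra = nonunital_algebra +
  assumes nilpotent: "\<exists>k>0. alg_pow k = {\<zero>}"

(* The neutral element of the circle operation is the zero of A. *)
definition circle_monoid :: "('a, 'm) ring_scheme \<Rightarrow> 'a monoid" where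
  "circle_monoid A = \<lparr>carrier = carrier A,
     monoid.mult = \<lambda>a b. a \<oplus>\<^bsub>A\<^esub> b \<oplus>\<^bsub>A\<^esub> a \<otimes>\<^bsub>A\<^esub> b, one = \<zero>\<^bsub>A\<^esub>\<rparr>"

end

theory Submission
  imports Defs
begin

text \<open>
  If \<open>a'\<close> is the circle inverse of \<open>a\<close>, then expanding gives
  \<open>(a + b) \<circ> a' \<circ> (a + c) = a + (b \<circ> c) + b a' c\<close>, while the first brace axiom always holds.
  So the second one says \<open>b a' c = 0\<close> for all \<open>a\<close>, \<open>b\<close>, \<open>c\<close>, and every element is a circle
  inverse. Conversely, if \<open>A\<^sup>3 = 0\<close>, then \<open>a a - a\<close> is the circle inverse of \<open>a\<close>.
\<close>

text \<open>Every vector is a linear combination of a finite generating set, and over a finite field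
  there are only finitely many choices of coefficients. This supplies the finiteness that a bi-skew
  brace requires.\<close>

lemma (in vectorspace) finite_carrier_of_fin_dim:
  assumes "finite (carrier K)" and "fin_dim"
  shows "finite (carrier V)"
proof -
  obtain B where B: "finite B" "B \<subseteq> carrier V" "gen_set B"
    using assms(2) unfolding fin_dim_def by blast
  have "carrier V \<subseteq> (\<lambda>f. lincomb f B) ` (B \<rightarrow>\<^sub>E carrier K)"
  proof
    fix v assume "v \<in> carrier V"
    then have "v \<in> {lincomb f B | f. f \<in> B \<rightarrow> carrier K}"
      using B(3) finite_span[OF B(1,2)] by simp
    then obtain f where f: "f \<in> B \<rightarrow> carrier K" "v = lincomb f B"
      by blast
    \<comment> \<open>\<open>lincomb\<close> reads \<open>f\<close> on \<open>B\<close> only, so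
      \<open>f\<close> may be made extensional; the extensional coefficient functions form a finite
      set.\<close>
    have "lincomb (restrict f B) B = lincomb f B"
      unfolding lincomb_def using f B by (intro finsum_cong') (auto intro!: smult_closed)
    with f show "v \<in> (\<lambda>f. lincomb f B) ` (B \<rightarrow>\<^sub>E carrier K)"
      by (intro image_eqI[where x = "restrict f B"]) auto
  qed
  then show ?thesis
    using B(1) assms(1) by (meson finite_PiE finite_imageI finite_subset)
qed

context nonunital_algebra
begin

lemma mult_zero_left: "x \<in> carrier A \<Longrightarrow> \<zero> \<otimes> x = \<zero>"
  using mult_l_distr[of \<zero> \<zero> x] mult_closed[of \<zero> x] M.add.r_cancel_one' by simp

lemma mult_zero_right: "x \<in> carrier A \<Longrightarrow> x \<otimes> \<zero> = \<zero>"
  using mult_r_distr[of x \<zero> \<zero>] mult_closed[of x \<zero>] M.add.r_cancel_one' by simp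

lemma mult_minus_left:
  assumes "x \<in> carrier A" "y \<in> carrier A"
  shows "(\<ominus> x) \<otimes> y = \<ominus> (x \<otimes> y)"
proof -
  have "(\<ominus> x) \<otimes> y \<oplus> x \<otimes> y = \<zero>"
    using assms mult_l_distr[of "\<ominus> x" x y] by (simp add: M.l_neg mult_zero_left)
  then show ?thesis
    using assms by (simp add: M.minus_equality mult_closed)
qed

lemma mult_minus_right:
  assumes "x \<in> carrier A" "y \<in> carrier A"
  shows "x \<otimes> (\<ominus> y) = \<ominus> (x \<otimes> y)"
proof -
  have "x \<otimes> (\<ominus> y) \<oplus> x \<otimes> y = \<zero>"
    using assms mult_r_distr[of x "\<ominus> y" y] by (simp add: M.l_neg mult_zero_right)
  then show ?thesis
    using assms by (simp add: M.minus_equality mult_closed)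
qed

text \<open>A span is zero exactly when all its generators are zero, and the generators of
  \<open>alg_pow 3\<close> are the triple products.\<close>

lemma alg_pow_3_eq_zero_iff:
  "alg_pow 3 = {\<zero>} \<longleftrightarrow>
    (\<forall>a\<in>carrier A. \<forall>b\<in>carrier A. \<forall>c\<in>carrier A. a \<otimes> b \<otimes> c = \<zero>)"
proof -
  define G where "G = {a \<otimes> b \<otimes> c | a b c. a \<in> carrier A \<and> b \<in> carrier A \<and> c \<in> carrier A}"
  have "{foldl (\<otimes>) x xs | x xs. x \<in> carrier A \<and> set xs \<subseteq> carrier A \<and> Suc (length xs) = 3} = G"
  proof (intro equalityI subsetI)
    fix v assume "v \<in> {foldl (\<otimes>) x xs | x xs.
      x \<in> carrier A \<and> set xs \<subseteq> carrier A \<and> Suc (length xs) = 3}"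
    \<comment> \<open>The first factor is the start value of \<open>foldl\<close>, so three factors
      leave a list of length two.\<close>
    then obtain x xs where x: "v = foldl (\<otimes>) x xs" "x \<in> carrier A" "set xs \<subseteq> carrier A"
      and "length xs = Suc (Suc 0)" by auto
    from this(4) obtain y z where "xs = [y, z]"
      by (auto simp: length_Suc_conv)
    with x show "v \<in> G" unfolding G_def by auto
  next
    fix v assume "v \<in> G"
    then obtain a b c where abc: "a \<in> carrier A" "b \<in> carrier A" "c \<in> carrier A"
      and v: "v = a \<otimes> b \<otimes> c"
      unfolding G_def by blast
    have "v = foldl (\<otimes>) a [b, c] \<and> a \<in> carrier A \<and> set [b, c] \<subseteq> carrier A
        \<and> Suc (length [b, c]) = 3"
      using abc v by simp
    then show "v \<in> {foldl (\<otimes>) x xs | x xs.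
        x \<in> carrier A \<and> set xs \<subseteq> carrier A \<and> Suc (length xs) = 3}"
      by blast
  qed
  then have pow: "alg_pow 3 = span G"
    unfolding alg_pow_def by simp
  have G: "G \<subseteq> carrier A"
    unfolding G_def using mult_closed by blast
  have "span G = {\<zero>} \<longleftrightarrow> G \<subseteq> {\<zero>}"
  proof
    assume "span G = {\<zero>}"
    then show "G \<subseteq> {\<zero>}" using in_own_span[OF G] by simp
  next
    assume "G \<subseteq> {\<zero>}"
    \<comment> \<open>The zero subspace is written as \<open>span {}\<close>, so that minimality of
      the span of \<open>G\<close> applies.\<close>
    then have "G \<subseteq> span {}" by (simp add: span_empty)
    then have "span G \<subseteq> span {}"
      by (intro span_is_subset span_is_submodule) auto
    then show "span G = {\<zero>}"
      using span_zero[of G] by (auto simp: span_empty)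
  qed
  then show ?thesis
    unfolding pow G_def by blast
qed

text \<open>Both sides expand to x + y + z + xy + xz + yz + xyz.\<close>

lemma circle_mult_assoc:
  assumes "x \<in> carrier A" "y \<in> carrier A" "z \<in> carrier A"
  shows "(x \<oplus> y \<oplus> x \<otimes> y) \<oplus> z \<oplus> (x \<oplus> y \<oplus> x \<otimes> y) \<otimes> z
    = x \<oplus> (y \<oplus> z \<oplus> y \<otimes> z) \<oplus> x \<otimes> (y \<oplus> z \<oplus> y \<otimes> z)"
  using assms by (simp add: mult_closed mult_assoc mult_l_distr mult_r_distr M.a_ac)

text \<open>This is the first brace axiom: both sides reduce to a + b + c + ab + ac, because -a
  cancels one of the two copies of a on the right.\<close>

lemma circle_brace:
  assumes "a \<in> carrier A" "b \<in> carrier A" "c \<in> carrier A"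
  shows "a \<oplus> (b \<oplus> c) \<oplus> a \<otimes> (b \<oplus> c)
    = (a \<oplus> b \<oplus> a \<otimes> b) \<oplus> \<ominus> a \<oplus> (a \<oplus> c \<oplus> a \<otimes> c)"
proof -
  have "(a \<oplus> b \<oplus> a \<otimes> b) \<oplus> \<ominus> a \<oplus> (a \<oplus> c \<oplus> a \<otimes> c)
      = (a \<oplus> b \<oplus> a \<otimes> b) \<oplus> ((\<ominus> a \<oplus> a) \<oplus> (c \<oplus> a \<otimes> c))"
    using assms by (simp add: mult_closed M.a_assoc)
  also have "(\<ominus> a \<oplus> a) \<oplus> (c \<oplus> a \<otimes> c) = c \<oplus> a \<otimes> c"
    using assms by (simp add: M.l_neg mult_closed)
  also have "(a \<oplus> b \<oplus> a \<otimes> b) \<oplus> (c \<oplus> a \<otimes> c) = a \<oplus> (b \<oplus> c) \<oplus> a \<otimes> (b \<oplus> c)"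
    using assms by (simp add: mult_closed mult_r_distr M.a_ac)
  finally show ?thesis by simp
qed

text \<open>The term b a' c measures the failure of the second brace axiom. The inverse a' enters
  through its two equations, so the computation is independent of any group structure on
  \<open>circle_monoid A\<close>.\<close>

lemma circle_dual_brace_defect:
  assumes "a \<in> carrier A" "b \<in> carrier A" "c \<in> carrier A" "a' \<in> carrier A"
    and right: "a \<oplus> a' \<oplus> a \<otimes> a' = \<zero>" and left: "a' \<oplus> a \<oplus> a' \<otimes> a = \<zero>"
  defines "u \<equiv> (a \<oplus> b) \<oplus> a' \<oplus> (a \<oplus> b) \<otimes> a'"
  shows "u \<oplus> (a \<oplus> c) \<oplus> u \<otimes> (a \<oplus> c) = a \<oplus> (b \<oplus> c \<oplus> b \<otimes> c) \<oplus> b \<otimes> a' \<otimes> c"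
proof -
  \<comment> \<open>The first bracket is the circle product of a and a', zero by
    \<open>right\<close>.\<close>
  have "u = (a \<oplus> a' \<oplus> a \<otimes> a') \<oplus> (b \<oplus> b \<otimes> a')"
    unfolding u_def using assms(1-4) by (simp add: mult_closed mult_l_distr M.a_ac)
  then have u: "u = b \<oplus> b \<otimes> a'"
    using assms(1-4) right by (simp add: mult_closed)
  \<comment> \<open>The terms ba', ba and ba'a combine to b times the circle product of a' and a,
    zero by \<open>left\<close>.\<close>
  have "u \<oplus> (a \<oplus> c) \<oplus> u \<otimes> (a \<oplus> c)
      = (a \<oplus> (b \<oplus> c \<oplus> b \<otimes> c) \<oplus> b \<otimes> a' \<otimes> c) \<oplus> b \<otimes> (a' \<oplus> a \<oplus> a' \<otimes> a)"
    unfolding u using assms(1-4)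
    by (simp add: mult_closed mult_assoc mult_l_distr mult_r_distr M.a_ac)
  then show ?thesis
    using assms(1-4) left by (simp add: mult_closed mult_zero_right)
qed

text \<open>The circle product is multiplication of formal elements 1 + a. The witness comes from
  the geometric series 1 - a + aa - ... for the inverse of 1 + a, which stops after aa when aaa =
  0.\<close>

lemma circle_inverse_if_triple_products_zero:
  assumes "a \<in> carrier A" and "a \<otimes> a \<otimes> a = \<zero>"
  shows "a \<oplus> (a \<otimes> a \<oplus> \<ominus> a) \<oplus> a \<otimes> (a \<otimes> a \<oplus> \<ominus> a) = \<zero>"
    and "(a \<otimes> a \<oplus> \<ominus> a) \<oplus> a \<oplus> (a \<otimes> a \<oplus> \<ominus> a) \<otimes> a = \<zero>"
proof -
  have sum: "(a \<otimes> a \<oplus> \<ominus> a) \<oplus> a = a \<otimes> a"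
    using assms(1) by (simp add: mult_closed M.a_assoc M.l_neg)
  have "a \<otimes> (a \<otimes> a \<oplus> \<ominus> a) = \<ominus> (a \<otimes> a)"
    using assms mult_assoc[of a a a] by (simp add: mult_closed mult_r_distr mult_minus_right)
  then show "a \<oplus> (a \<otimes> a \<oplus> \<ominus> a) \<oplus> a \<otimes> (a \<otimes> a \<oplus> \<ominus> a) = \<zero>"
    using assms(1) sum M.a_comm[of a "a \<otimes> a \<oplus> \<ominus> a"]
    by (simp add: mult_closed M.r_neg)
  have "(a \<otimes> a \<oplus> \<ominus> a) \<otimes> a = \<ominus> (a \<otimes> a)"
    using assms by (simp add: mult_closed mult_l_distr mult_minus_left)
  then show "(a \<otimes> a \<oplus> \<ominus> a) \<oplus> a \<oplus> (a \<otimes> a \<oplus> \<ominus> a) \<otimes> a = \<zero>"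
    using assms(1) sum by (simp add: mult_closed M.r_neg)
qed

text \<open>By \<open>groupI\<close>, left inverses suffice once associativity and the left neutral
  element are known.\<close>

lemma group_circle_monoid:
  assumes "\<And>a. a \<in> carrier A \<Longrightarrow> \<exists>a'\<in>carrier A. a' \<oplus> a \<oplus> a' \<otimes> a = \<zero>"
  shows "group (circle_monoid A)"
proof (rule groupI)
  fix x y z
  assume "x \<in> carrier (circle_monoid A)" "y \<in> carrier (circle_monoid A)"
    "z \<in> carrier (circle_monoid A)"
  then show "x \<otimes>\<^bsub>circle_monoid A\<^esub> y \<otimes>\<^bsub>circle_monoid A\<^esub> z
      = x \<otimes>\<^bsub>circle_monoid A\<^esub> (y \<otimes>\<^bsub>circle_monoid A\<^esub> z)"
    using circle_mult_assoc[of x y z] by (simp add: circle_monoid_def)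
qed (use assms in \<open>auto simp: circle_monoid_def mult_closed mult_zero_left\<close>)

text \<open>Circle inverses come from the brace itself in one direction and from the truncated
  geometric series in the other. Either way the second axiom amounts to the vanishing of the
  defect.\<close>

lemma bi_skew_brace_circle_iff:
  assumes "finite (carrier A)"
  shows "bi_skew_brace (circle_monoid A) (add_monoid A) \<longleftrightarrow>
    (\<forall>a\<in>carrier A. \<forall>b\<in>carrier A. \<forall>c\<in>carrier A. a \<otimes> b \<otimes> c = \<zero>)"
    (is "?brace \<longleftrightarrow> ?triple")
proof
  assume ?brace
  then interpret bsb: bi_skew_brace "circle_monoid A" "add_monoid A" .
  show ?triple
  proof (intro ballI)
    fix b a c assume abc: "b \<in> carrier A" "a \<in> carrier A" "c \<in> carrier A"
    \<comment> \<open>The axiom is applied at the inverse \<open>i\<close> of \<open>a\<close>: the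
      middle factor of the defect is then \<open>a\<close> itself, which is arbitrary.\<close>
    define i where "i = inv\<^bsub>circle_monoid A\<^esub> a"
    have aC: "a \<in> carrier (circle_monoid A)"
      using abc by (simp add: circle_monoid_def)
    have i: "i \<in> carrier A"
      using bsb.circ.inv_closed[OF aC] by (simp add: i_def circle_monoid_def)
    have inv_i: "inv\<^bsub>circle_monoid A\<^esub> i = a"
      using bsb.circ.inv_inv[OF aC] by (simp add: i_def)
    have "i \<oplus> a \<oplus> i \<otimes> a = \<zero>"
      using bsb.circ.l_inv[OF aC] by (simp add: i_def circle_monoid_def)
    moreover have "a \<oplus> i \<oplus> a \<otimes> i = \<zero>"
      using bsb.circ.r_inv[OF aC] by (simp add: i_def circle_monoid_def)
    ultimately have "((i \<oplus> b) \<oplus> a \<oplus> (i \<oplus> b) \<otimes> a) \<oplus> (i \<oplus> c)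
          \<oplus> ((i \<oplus> b) \<oplus> a \<oplus> (i \<oplus> b) \<otimes> a) \<otimes> (i \<oplus> c)
        = i \<oplus> (b \<oplus> c \<oplus> b \<otimes> c) \<oplus> b \<otimes> a \<otimes> c"
      using abc i by (intro circle_dual_brace_defect)
    moreover have "i \<otimes>\<^bsub>add_monoid A\<^esub> (b \<otimes>\<^bsub>circle_monoid A\<^esub> c)
        = (i \<otimes>\<^bsub>add_monoid A\<^esub> b) \<otimes>\<^bsub>circle_monoid A\<^esub> a
          \<otimes>\<^bsub>circle_monoid A\<^esub> (i \<otimes>\<^bsub>add_monoid A\<^esub> c)"
      using bsb.dual_brace[of i b c] abc i unfolding inv_i by simp
    \<comment> \<open>The axiom and the defect formula evaluate the same circle product, so the
      defect \<open>b \<otimes> a \<otimes> c\<close> can be cancelled out as zero.\<close>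
    ultimately have "i \<oplus> (b \<oplus> c \<oplus> b \<otimes> c) \<oplus> b \<otimes> a \<otimes> c = i \<oplus> (b \<oplus> c \<oplus> b \<otimes> c)"
      unfolding circle_monoid_def by simp
    then show "b \<otimes> a \<otimes> c = \<zero>"
      using abc i M.add.r_cancel_one[of "i \<oplus> (b \<oplus> c \<oplus> b \<otimes> c)" "b \<otimes> a \<otimes> c"]
      by (simp add: mult_closed)
  qed
next
  assume triple: ?triple
  interpret C: group "circle_monoid A"
  proof (rule group_circle_monoid)
    fix a assume "a \<in> carrier A"
    with triple show "\<exists>a'\<in>carrier A. a' \<oplus> a \<oplus> a' \<otimes> a = \<zero>"
      using circle_inverse_if_triple_products_zero(2)[of a]
      by (meson M.a_closed M.a_inv_closed mult_closed)
  qed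
  show ?brace
  proof (intro bi_skew_brace.intro bi_skew_brace_axioms.intro)
    show "group (circle_monoid A)" by (rule C.is_group)
    show "group (add_monoid A)" by (rule M.a_group)
    show "carrier (circle_monoid A) = carrier (add_monoid A)"
      by (simp add: circle_monoid_def)
    show "finite (carrier (add_monoid A))" using assms by simp
  next
    fix a b c
    assume "a \<in> carrier (add_monoid A)" "b \<in> carrier (add_monoid A)"
      "c \<in> carrier (add_monoid A)"
    then have abc: "a \<in> carrier A" "b \<in> carrier A" "c \<in> carrier A" by simp_all
    show "a \<otimes>\<^bsub>circle_monoid A\<^esub> (b \<otimes>\<^bsub>add_monoid A\<^esub> c)
        = (a \<otimes>\<^bsub>circle_monoid A\<^esub> b) \<otimes>\<^bsub>add_monoid A\<^esub> inv\<^bsub>add_monoid A\<^esub> a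
          \<otimes>\<^bsub>add_monoid A\<^esub> (a \<otimes>\<^bsub>circle_monoid A\<^esub> c)"
      using circle_brace[OF abc] by (simp add: circle_monoid_def a_inv_def)
    define i where "i = inv\<^bsub>circle_monoid A\<^esub> a"
    have aC: "a \<in> carrier (circle_monoid A)"
      using abc by (simp add: circle_monoid_def)
    have i: "i \<in> carrier A"
      using C.inv_closed[OF aC] by (simp add: i_def circle_monoid_def)
    have "i \<oplus> a \<oplus> i \<otimes> a = \<zero>"
      using C.l_inv[OF aC] by (simp add: i_def circle_monoid_def)
    moreover have "a \<oplus> i \<oplus> a \<otimes> i = \<zero>"
      using C.r_inv[OF aC] by (simp add: i_def circle_monoid_def)
    \<comment> \<open>This is the defect at \<open>a\<close>, a triple product with the inverse of
      \<open>a\<close> in the middle.\<close>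
    moreover have "b \<otimes> i \<otimes> c = \<zero>"
      using triple abc i by blast
    ultimately have "a \<otimes>\<^bsub>add_monoid A\<^esub> (b \<otimes>\<^bsub>circle_monoid A\<^esub> c)
        = (a \<otimes>\<^bsub>add_monoid A\<^esub> b) \<otimes>\<^bsub>circle_monoid A\<^esub> i
          \<otimes>\<^bsub>circle_monoid A\<^esub> (a \<otimes>\<^bsub>add_monoid A\<^esub> c)"
      using circle_dual_brace_defect[of a b c i] abc i
      by (simp add: circle_monoid_def mult_closed)
    then show "a \<otimes>\<^bsub>add_monoid A\<^esub> (b \<otimes>\<^bsub>circle_monoid A\<^esub> c)
        = (a \<otimes>\<^bsub>add_monoid A\<^esub> b) \<otimes>\<^bsub>circle_monoid A\<^esub> inv\<^bsub>circle_monoid A\<^esub> a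
          \<otimes>\<^bsub>circle_monoid A\<^esub> (a \<otimes>\<^bsub>add_monoid A\<^esub> c)"
      unfolding i_def .
  qed
qed

end

theorem proposition4p1:
  fixes p n :: nat and A :: "(int, 'a, 'm) module_scheme"
  assumes "prime p"
    and "nilpotent_algebra (residue_ring (int p)) A"
    and "vectorspace.fin_dim (residue_ring (int p)) A"
    and "vectorspace.dim (residue_ring (int p)) A = n"
  shows "(bi_skew_brace (circle_monoid A) (add_monoid A) \<longleftrightarrow>
            nonunital_algebra.alg_pow (residue_ring (int p)) A 3 = {\<zero>\<^bsub>A\<^esub>}) \<and>
         (nonunital_algebra.alg_pow (residue_ring (int p)) A 3 = {\<zero>\<^bsub>A\<^esub>} \<longleftrightarrow>
            (\<forall>a\<in>carrier A. \<forall>b\<in>carrier A. \<forall>c\<in>carrier A.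
               a \<otimes>\<^bsub>A\<^esub> b \<otimes>\<^bsub>A\<^esub> c = \<zero>\<^bsub>A\<^esub>))"
proof -
  interpret nilpotent_algebra "residue_ring (int p)" A by (rule assms(2))
  have "finite (carrier (residue_ring (int p)))"
    by (simp add: residue_ring_def)
  then have "finite (carrier A)"
    using assms(3) by (rule finite_carrier_of_fin_dim)
  then show ?thesis
    using bi_skew_brace_circle_iff alg_pow_3_eq_zero_iff by blast
qed

end
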